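(* Let $M$ be a compact metric space, let $N>0$ be an integer, and let $X^t$ be a flow on $M$. If $X^t$ is $N$-expansive, then $X^t$ is $cw$-expansive.
   Context: A flow on a compact metric space $M$ is a family $X^t=\{X^t\}_{t\in\mathbb{R}}$ of homeomorphisms of $M$ with $X^0(x)=x$ and $X^{t+s}(x)=X^t(X^s(x))$ for all $x\in M$, $s,t\in\mathbb{R}$, such that $(t,x)\mapsto X^t(x)$ is continuous. For $I\subset\mathbb{R}$ and $B\subset M$, $X^{I}(B)=\{X^t(b): t\in I,\ b\in B\}$, and $X^I(x)=X^I(\{x\})$. A continuum is a compact connected set. Let $\mathrm{Hom}_0(\mathbb{R})$ be the set of homeomorphisms of $\mathbb{R}$ fixing $0$. For $A\subset M$, $\mathcal{H}(A)$ is the set of maps $\alpha:A\to \mathrm{Hom}_0(\mathbb{R})$ such that there is a point $x_\alpha\in A$ with $\alpha(x_\alpha)=\mathrm{id}_{\mathbb{R}}$, and such that for each $t\in\mathbb{R}$ the map $A\to\mathbb{R}$, $x\mapsto\alpha(x)(t)$, is continuous. For $t\in\mathbb{R}$ and $\alpha\in\mathcal{H}(A)$, put $\mathcal{X}^t_\alpha(A)=\{X^{\alpha(x)(t)}(x): x\in A\}$. $N$-expansive: for every $\epsilon>0$ there is $\delta>0$ such that whenever $A\subset M$ and $\alpha\in\mathcal{H}(A)$ satisfy $\operatorname{diam}(\mathcal{X}^t_\alpha(A))<\delta$ for all $t\in\mathbb{R}$, there is a subset $B\subset A$ of cardinality less than $N+1$ with $A\subset X^{(-\epsilon,\epsilon)}(B)$.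 $cw$-expansive: for every $\epsilon>0$ there is $\delta>0$ such that whenever $A\subset M$ is a continuum and $\alpha\in\mathcal{H}(A)$ satisfy $\operatorname{diam}(\mathcal{X}^t_\alpha(A))<\delta$ for all $t\in\mathbb{R}$, one has $A\subset X^{(-\epsilon,\epsilon)}(x_\alpha)$. *)

theory Defs
  imports "HOL-Analysis.Analysis"
begin

text \<open>The compact metric space is a compact set M in a type of class metric_space; values of
  the flow outside M play no role.\<close>

definition is_flow :: "'a::metric_space set \<Rightarrow> (real \<Rightarrow> 'a \<Rightarrow> 'a) \<Rightarrow> bool" where
  "is_flow M X \<longleftrightarrow>
     (\<forall>t. \<exists>g. homeomorphism M M (X t) g) \<and>
     (\<forall>x\<in>M. X 0 x = x) \<and>
     (\<forall>x\<in>M. \<forall>t s. X (t + s) x = X t (X s x)) \<and>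
     continuous_on (UNIV \<times> M) (\<lambda>(t, x). X t x)"

definition flow_image :: "(real \<Rightarrow> 'a \<Rightarrow> 'a) \<Rightarrow> real set \<Rightarrow> 'a set \<Rightarrow> 'a set" where
  "flow_image X I B = {X t b | t b. t \<in> I \<and> b \<in> B}"

definition continuum :: "'a::metric_space set \<Rightarrow> bool" where
  "continuum A \<longleftrightarrow> compact A \<and> connected A"

definition Hom0 :: "(real \<Rightarrow> real) set" where
  "Hom0 = {h. (\<exists>g. homeomorphism UNIV UNIV h g) \<and> h 0 = 0}"

text \<open>A map from A to Hom0 is a total function of which only the values on A matter.\<close>

definition reparams :: "'a::metric_space set \<Rightarrow> ('a \<Rightarrow> real \<Rightarrow> real) set" where
  "reparams A = {\<alpha> \<in> A \<rightarrow> Hom0.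
     (\<exists>x\<in>A. \<alpha> x = id) \<and> (\<forall>t. continuous_on A (\<lambda>x. \<alpha> x t))}"

definition reparam_image ::
  "(real \<Rightarrow> 'a \<Rightarrow> 'a) \<Rightarrow> ('a \<Rightarrow> real \<Rightarrow> real) \<Rightarrow> real \<Rightarrow> 'a set \<Rightarrow> 'a set" where
  "reparam_image X \<alpha> t A = (\<lambda>x. X (\<alpha> x t) x) ` A"

definition N_expansive ::
  "nat \<Rightarrow> 'a::metric_space set \<Rightarrow> (real \<Rightarrow> 'a \<Rightarrow> 'a) \<Rightarrow> bool" where
  "N_expansive N M X \<longleftrightarrow>
     (\<forall>\<epsilon>>0. \<exists>\<delta>>0. \<forall>A \<alpha>. A \<subseteq> M \<and> \<alpha> \<in> reparams A \<and>
        (\<forall>t. diameter (reparam_image X \<alpha> t A) < \<delta>) \<longrightarrow>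
        (\<exists>B\<subseteq>A. finite B \<and> card B < N + 1 \<and> A \<subseteq> flow_image X {-\<epsilon><..<\<epsilon>} B))"

text \<open>The base point of a reparametrization (a point where it is the identity) need not be
  unique; the conclusion is required for every such point.\<close>

definition cw_expansive :: "'a::metric_space set \<Rightarrow> (real \<Rightarrow> 'a \<Rightarrow> 'a) \<Rightarrow> bool" where
  "cw_expansive M X \<longleftrightarrow>
     (\<forall>\<epsilon>>0. \<exists>\<delta>>0. \<forall>A \<alpha>. A \<subseteq> M \<and> continuum A \<and> \<alpha> \<in> reparams A \<and>
        (\<forall>t. diameter (reparam_image X \<alpha> t A) < \<delta>) \<longrightarrow>
        (\<forall>x\<in>A. \<alpha> x = id \<longrightarrow> A \<subseteq> flow_image X {-\<epsilon><..<\<epsilon>} {x}))"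

end

theory Submission imports Defs begin

text \<open>Apply \<open>N\<close>-expansiveness with \<open>\<epsilon> / (2 * N + 1)\<close>. It covers \<open>A\<close> by at most \<open>N\<close> orbit arcs of
  time length \<open>2 * \<epsilon> / (2 * N + 1)\<close>. Since \<open>A\<close> is connected, any two of its points are joined by a
  chain in \<open>A\<close> of at most \<open>N\<close> steps, each within a single arc, so they lie on one orbit at time
  distance at most \<open>2 * N * \<epsilon> / (2 * N + 1) < \<epsilon>\<close>.\<close>

text \<open>Read \<open>P k y\<close> as: \<open>y\<close> is reached from \<open>x\<close> in
  \<open>k\<close> steps, each inside one member of the cover. Members are absorbed one at a time:
  connectedness makes the closed union already reached meet the closed union still missing at a
  point of \<open>A\<close>, and one more step from there reaches a whole new member.\<close>

lemma connected_finite_closed_cover_chain: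
  fixes A :: "'a::t1_space set"
  assumes "connected A" and "finite I" and closed: "\<And>i. i \<in> I \<Longrightarrow> closed (F i)"
    and cover: "A \<subseteq> (\<Union>i\<in>I. F i)"
    and "x \<in> A" and "P 0 x"
    and step: "\<And>k i y z. P k z \<Longrightarrow> i \<in> I \<Longrightarrow> z \<in> A \<inter> F i \<Longrightarrow> y \<in> A \<inter> F i \<Longrightarrow> P (Suc k) y"
    and "y \<in> A"
  shows "\<exists>k\<le>card I. P k y"
proof -
  \<comment> \<open>Invariant: after absorbing \<open>m\<close> members, every point of
    \<open>A\<close> in them is at most \<open>m\<close> steps away. Inserting \<open>x\<close>
    gives the induction a nonempty reached set even when \<open>J\<close> is empty.\<close>
  have "\<exists>J\<subseteq>I. card J = m \<and> (\<forall>y\<in>A \<inter> (insert x (\<Union>i\<in>J. F i)). \<exists>k\<le>m. P k y)"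
    if "m \<le> card I" for m
    using that
  proof (induction m)
    case 0
    then show ?case using \<open>P 0 x\<close> by (intro exI[of _ "{}"]) auto
  next
    case (Suc m)
    then obtain J where J: "J \<subseteq> I" "card J = m"
      and P: "\<And>y. y \<in> A \<inter> insert x (\<Union>i\<in>J. F i) \<Longrightarrow> \<exists>k\<le>m. P k y"
      by (auto simp del: Int_iff)
    have "finite J" using J \<open>finite I\<close> finite_subset by blast
    let ?U = "insert x (\<Union>i\<in>J. F i)" and ?V = "\<Union>i\<in>I - J. F i"
    have "\<exists>j\<in>I - J. \<forall>y\<in>A \<inter> F j. \<exists>k\<le>Suc m. P k y"
    proof (cases "A \<inter> ?V = {}")
      \<comment> \<open>The missing members do not meet \<open>A\<close>, so any one of them can be
        absorbed vacuously; one exists because \<open>m < card I\<close>.\<close>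
      case True
      moreover have "I - J \<noteq> {}"
        using Suc.prems J by auto
      ultimately show ?thesis by blast
    next
      case False
      \<comment> \<open>Finite unions of closed sets; the added point \<open>x\<close> is closed by
        the T1 axiom.\<close>
      have "closed ?U" "closed ?V"
        using J closed \<open>finite I\<close> \<open>finite J\<close> by (auto intro!: closed_insert)
      moreover have "A \<subseteq> ?U \<union> ?V" using cover by auto
      ultimately have "A \<inter> ?U \<inter> ?V \<noteq> {}"
        using connected_closedD[OF \<open>connected A\<close>, of ?U ?V] False \<open>x \<in> A\<close> by auto
      then obtain z j where z: "z \<in> A" "z \<in> ?U" and j: "j \<in> I - J" "z \<in> F j" by blast
      then obtain k where "k \<le> m" "P k z" using P by blast
      then have "\<exists>k\<le>Suc m. P k y" if "y \<in> A \<inter> F j" for y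
        using step[of k z j y] z j that by (intro exI[of _ "Suc k"]) auto
      with j show ?thesis by blast
    qed
    then obtain j where j: "j \<in> I - J" "\<And>y. y \<in> A \<inter> F j \<Longrightarrow> \<exists>k\<le>Suc m. P k y" by blast
    have "\<exists>k\<le>Suc m. P k y" if "y \<in> A \<inter> insert x (\<Union>i\<in>insert j J. F i)" for y
    proof (cases "y \<in> F j")
      case True
      with j(2) that show ?thesis by blast
    next
      case False
      then have "y \<in> A \<inter> ?U" using that by blast
      then obtain k where "k \<le> m" "P k y" using P by blast
      then show ?thesis using le_SucI by blast
    qed
    then show ?case
      using J j \<open>finite J\<close> by (intro exI[of _ "insert j J"]) auto
  qed
  from this[OF order_refl] obtain J where "J \<subseteq> I" "card J = card I"
    and P: "\<forall>y\<in>A \<inter> insert x (\<Union>i\<in>J. F i). \<exists>k\<le>card I. P k y" by blast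
  then have "J = I" using \<open>finite I\<close> card_subset_eq by blast
  with P cover \<open>y \<in> A\<close> show ?thesis by blast
qed

text \<open>Two points on the same arc of times between \<open>-e\<close> and \<open>e\<close>
  differ by a time of at most \<open>2 * e\<close>, so a chain through at most \<open>card B\<close>
  arcs costs less than \<epsilon> in total.\<close>

lemma connected_subset_flow_image:
  assumes flow: "is_flow M X" and "connected A" and "A \<subseteq> M" and "B \<subseteq> M" and "finite B"
    and cover: "A \<subseteq> flow_image X {-e<..<e} B"
    and "x \<in> A" and less: "2 * real (card B) * e < \<epsilon>" and "e > 0"
  shows "A \<subseteq> flow_image X {-\<epsilon><..<\<epsilon>} {x}"
proof
  fix y assume "y \<in> A"
  have zero: "X 0 p = p" and add: "X (t + s) p = X t (X s p)" if "p \<in> M" for p t s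
    using flow that by (auto simp: is_flow_def)
  have cont: "continuous_on (UNIV \<times> M) (\<lambda>(t, x). X t x)"
    using flow by (auto simp: is_flow_def)
  \<comment> \<open>Closed time intervals make the arcs compact, hence closed as the chain argument
    requires; the strict bound is recovered at the end from \<open>less\<close>.\<close>
  let ?F = "\<lambda>b. (\<lambda>s. X s b) ` {-e..e}"
  have "closed (?F b)" if "b \<in> B" for b
  proof -
    have "continuous_on {-e..e} (\<lambda>s. (\<lambda>(t, x). X t x) (s, b))"
      using that \<open>B \<subseteq> M\<close>
      by (intro continuous_on_compose2[OF cont] continuous_intros) auto
    then show ?thesis
      by (intro compact_imp_closed compact_continuous_image) auto
  qed
  moreover have "A \<subseteq> (\<Union>b\<in>B. ?F b)"
    using cover by (fastforce simp: flow_image_def)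
  moreover have "\<exists>s. \<bar>s\<bar> \<le> 2 * real 0 * e \<and> x = X s x"
    using zero \<open>x \<in> A\<close> \<open>A \<subseteq> M\<close> by force
  moreover have "\<exists>s. \<bar>s\<bar> \<le> 2 * real (Suc k) * e \<and> y = X s x"
    if prems: "\<exists>s. \<bar>s\<bar> \<le> 2 * real k * e \<and> z = X s x" "b \<in> B"
      "z \<in> A \<inter> ?F b" "y \<in> A \<inter> ?F b" for k b y z
  proof -
    obtain s where s: "\<bar>s\<bar> \<le> 2 * real k * e" "z = X s x"
      using prems(1) by blast
    obtain u v where "u \<in> {-e..e}" "v \<in> {-e..e}" and u: "y = X u b" and v: "z = X v b"
      using prems(3,4) by blast
    then have "\<bar>u\<bar> \<le> e" "\<bar>v\<bar> \<le> e" by auto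
    have "b \<in> M" "x \<in> M" using \<open>b \<in> B\<close> \<open>B \<subseteq> M\<close> \<open>x \<in> A\<close> \<open>A \<subseteq> M\<close> by auto
    \<comment> \<open>Flow from \<open>z\<close> back to the centre \<open>b\<close> by time
      \<open>-v\<close>, then on to \<open>y\<close> by time \<open>u\<close>.\<close>
    have "y = X (u - v) z"
      using add[of b "u - v" v] \<open>b \<in> M\<close> u v by simp
    then have "y = X (u - v + s) x"
      using add[of x "u - v" s] \<open>x \<in> M\<close> s by simp
    moreover have "\<bar>u - v + s\<bar> \<le> 2 * real (Suc k) * e"
      using s \<open>\<bar>u\<bar> \<le> e\<close> \<open>\<bar>v\<bar> \<le> e\<close> by (simp add: algebra_simps)
    ultimately show ?thesis by blast
  qed
  ultimately have "\<exists>k\<le>card B. \<exists>s. \<bar>s\<bar> \<le> 2 * real k * e \<and> y = X s x"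
    by (rule connected_finite_closed_cover_chain[OF \<open>connected A\<close> \<open>finite B\<close> _ _ \<open>x \<in> A\<close> _ _ \<open>y \<in> A\<close>,
          where P = "\<lambda>k y. \<exists>s. \<bar>s\<bar> \<le> 2 * real k * e \<and> y = X s x"])
  then obtain k s where "k \<le> card B" and s: "\<bar>s\<bar> \<le> 2 * real k * e" "y = X s x" by blast
  then have "2 * real k * e \<le> 2 * real (card B) * e"
    using \<open>e > 0\<close> by simp
  with s less have "\<bar>s\<bar> < \<epsilon>" by linarith
  then show "y \<in> flow_image X {-\<epsilon><..<\<epsilon>} {x}"
    using s by (auto simp: flow_image_def)
qed

theorem theorem1:
  fixes M :: "'a::metric_space set" and X :: "real \<Rightarrow> 'a \<Rightarrow> 'a" and N :: nat
  assumes "compact M"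
    and "N > 0"
    and "is_flow M X"
    and "N_expansive N M X"
  shows "cw_expansive M X"
  unfolding cw_expansive_def
proof (intro allI impI)
  fix \<epsilon> :: real assume "\<epsilon> > 0"
  define e where "e = \<epsilon> / (2 * real N + 1)"
  have "e > 0" using \<open>\<epsilon> > 0\<close> by (simp add: e_def)
  \<comment> \<open>The number of arcs is only known to be at most \<open>N\<close>, hence the
    estimate for every such \<open>n\<close>; the summand 1 in the denominator of \<open>e\<close>
    makes it strict.\<close>
  have bound: "2 * real n * e < \<epsilon>" if "n \<le> N" for n
  proof -
    have "2 * real n * e \<le> 2 * real N * e" using that \<open>e > 0\<close> by simp
    also have "\<dots> < (2 * real N + 1) * e" using \<open>e > 0\<close> by (simp add: algebra_simps)
    also have "\<dots> = \<epsilon>" by (simp add: e_def add_nonneg_eq_0_iff)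
    finally show ?thesis .
  qed
  obtain \<delta> where "\<delta> > 0" and \<delta>: "\<And>A \<alpha>. A \<subseteq> M \<Longrightarrow> \<alpha> \<in> reparams A \<Longrightarrow>
      (\<forall>t. diameter (reparam_image X \<alpha> t A) < \<delta>) \<Longrightarrow>
      \<exists>B\<subseteq>A. finite B \<and> card B < N + 1 \<and> A \<subseteq> flow_image X {-e<..<e} B"
    using \<open>N_expansive N M X\<close> \<open>e > 0\<close> unfolding N_expansive_def by meson
  \<comment> \<open>The \<delta> that \<open>N\<close>-expansiveness gives for \<open>e\<close>
    serves for \<epsilon> in the conclusion.\<close>
  have "A \<subseteq> flow_image X {-\<epsilon><..<\<epsilon>} {x}"
    if A: "A \<subseteq> M" "continuum A" "\<alpha> \<in> reparams A"
      "\<forall>t. diameter (reparam_image X \<alpha> t A) < \<delta>" and "x \<in> A" for A \<alpha> x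
  proof -
    obtain B where B: "B \<subseteq> A" "finite B" "card B < N + 1" "A \<subseteq> flow_image X {-e<..<e} B"
      using \<delta>[OF A(1,3,4)] by blast
    show ?thesis
      by (rule connected_subset_flow_image[OF \<open>is_flow M X\<close> _ \<open>A \<subseteq> M\<close> _ B(2,4) \<open>x \<in> A\<close> bound])
        (use A B \<open>e > 0\<close> in \<open>auto simp: continuum_def\<close>)
  qed
  with \<open>\<delta> > 0\<close> show "\<exists>\<delta>>0. \<forall>A \<alpha>. A \<subseteq> M \<and> continuum A \<and> \<alpha> \<in> reparams A \<and>
        (\<forall>t. diameter (reparam_image X \<alpha> t A) < \<delta>) \<longrightarrow>
        (\<forall>x\<in>A. \<alpha> x = id \<longrightarrow> A \<subseteq> flow_image X {-\<epsilon><..<\<epsilon>} {x})"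
    by blast
qed

end
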